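(* Let $r\ge 2$ and let $H$ be a connected $r$-uniform hypergraph on $n$ vertices with diameter $D$ and spectral radius $\rho=\rho(H)$. If $H'$ is a proper sub-hypergraph of $H$, then $$\rho(H)-\rho(H')\ge\min\left\{\frac{r}{n\rho^{r(r-1)(D+1)}},\ \frac{1}{n\rho^{rD}(\rho^{r-1}+r-1)}\right\}.$$
   Context: A hypergraph $H=(V(H),E(H))$ on $n$ vertices has a (nonempty) vertex set $V(H)$ with $n$ elements, labelled $1,\dots,n$, and a set $E(H)$ of edges, which are subsets of $V(H)$; it is $r$-uniform if every edge contains exactly $r$ vertices. An $r$-uniform hypergraph $H'$ is a sub-hypergraph of $H$ if $V(H')\subseteq V(H)$ and $E(H')\subseteq E(H)$; it is proper if moreover $H'\ne H$. A path is an alternating sequence $v_1e_1v_2e_2\cdots v_\ell e_\ell v_{\ell+1}$ with $v_i,v_{i+1}\in e_i$ for $1\le i\le \ell$, all vertices and all edges in it being distinct; its length is the number $\ell$ of its edges. $H$ is connected if any two vertices are joined by a path; the distance between two vertices is the length of a shortest path connecting them, and the diameter of a connected hypergraph is the maximum distance between its vertices. The adjacency tensor $\mathcal{A}(H)$ is the order $r$, dimension $n$ tensor whose $(i_1i_2\cdots i_r)$-entry is $\frac{1}{(r-1)!}$ if $\{i_1,\dots,i_r\}\in E(H)$ and $0$ otherwise. For an order $r$ dimension $n$ tensor $\mathcal{A}=(a_{i_1\cdots i_r})$ and $x\in\mathbb{C}^n$, $\mathcal{A}x$ is the vector in $\mathbb{C}^n$ with $(\mathcal{A}x)_i=\sum_{i_2,\dots,i_r=1}^n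 a_{ii_2\cdots i_r}x_{i_2}\cdots x_{i_r}$. A number $\lambda\in\mathbb{C}$ is an eigenvalue of $\mathcal{A}$ with eigenvector $x\neq 0$ if $(\mathcal{A}x)_i=\lambda x_i^{r-1}$ for all $i$. The spectral radius $\rho(H)$ of an $r$-uniform hypergraph (connected or not) is the maximum modulus of the eigenvalues of its adjacency tensor. *)

theory Defs
  imports Complex_Main
begin

record 'a hypergraph =
  hverts :: "'a set"
  hedges :: "'a set set"

definition hypergraph :: "'a hypergraph \<Rightarrow> bool" where
  "hypergraph H \<longleftrightarrow>
     finite (hverts H) \<and> hverts H \<noteq> {} \<and> (\<forall>e\<in>hedges H. e \<subseteq> hverts H)"

definition uniform_hypergraph :: "nat \<Rightarrow> 'a hypergraph \<Rightarrow> bool" where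
  "uniform_hypergraph r H \<longleftrightarrow> hypergraph H \<and> (\<forall>e\<in>hedges H. card e = r)"

definition sub_hypergraph :: "nat \<Rightarrow> 'a hypergraph \<Rightarrow> 'a hypergraph \<Rightarrow> bool" where
  "sub_hypergraph r H' H \<longleftrightarrow>
     uniform_hypergraph r H' \<and> hverts H' \<subseteq> hverts H \<and> hedges H' \<subseteq> hedges H"

definition proper_sub_hypergraph :: "nat \<Rightarrow> 'a hypergraph \<Rightarrow> 'a hypergraph \<Rightarrow> bool" where
  "proper_sub_hypergraph r H' H \<longleftrightarrow> sub_hypergraph r H' H \<and> H' \<noteq> H"

text \<open>
  The alternating sequence of vertices and edges of a path is given by its list of vertices
  and its list of edges.  The trivial path, with one vertex and no edge, is allowed; it joins
  a vertex to itself.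
\<close>

definition hpath :: "'a hypergraph \<Rightarrow> 'a list \<Rightarrow> 'a set list \<Rightarrow> bool" where
  "hpath H vs es \<longleftrightarrow>
     length vs = length es + 1 \<and> set vs \<subseteq> hverts H \<and> set es \<subseteq> hedges H \<and>
     distinct vs \<and> distinct es \<and>
     (\<forall>i<length es. vs ! i \<in> es ! i \<and> vs ! Suc i \<in> es ! i)"

definition hpath_between ::
    "'a hypergraph \<Rightarrow> 'a \<Rightarrow> 'a list \<Rightarrow> 'a set list \<Rightarrow> 'a \<Rightarrow> bool" where
  "hpath_between H u vs es v \<longleftrightarrow> hpath H vs es \<and> hd vs = u \<and> last vs = v"

definition hconnected :: "'a hypergraph \<Rightarrow> bool" where
  "hconnected H \<longleftrightarrow>
     (\<forall>u\<in>hverts H. \<forall>v\<in>hverts H. \<exists>vs es. hpath_between H u vs es v)"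

definition hdist :: "'a hypergraph \<Rightarrow> 'a \<Rightarrow> 'a \<Rightarrow> nat" where
  "hdist H u v = (LEAST l. \<exists>vs es. hpath_between H u vs es v \<and> length es = l)"

definition hdiameter :: "'a hypergraph \<Rightarrow> nat" where
  "hdiameter H = Max {hdist H u v | u v. u \<in> hverts H \<and> v \<in> hverts H}"

text \<open>
  A tensor of order \<open>r\<close> whose indices range over a finite set \<open>I\<close> (its dimension is the
  cardinality of \<open>I\<close>) is a function on lists; only its values at lists over \<open>I\<close> of length
  \<open>r\<close> are entries of the tensor.  Taking the vertex set itself for \<open>I\<close> avoids having to
  renumber the vertices of a sub-hypergraph.  Likewise a vector is a function of which only
  the values on \<open>I\<close> matter.
\<close>

type_synonym 'a tensor = "'a list \<Rightarrow> complex"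

definition tensor_apply ::
    "nat \<Rightarrow> 'a set \<Rightarrow> 'a tensor \<Rightarrow> ('a \<Rightarrow> complex) \<Rightarrow> 'a \<Rightarrow> complex" where
  "tensor_apply r I A x i =
     (\<Sum>js | set js \<subseteq> I \<and> length js = r - 1. A (i # js) * prod_list (map x js))"

definition tensor_eigenvalue :: "nat \<Rightarrow> 'a set \<Rightarrow> 'a tensor \<Rightarrow> complex \<Rightarrow> bool" where
  "tensor_eigenvalue r I A c \<longleftrightarrow>
     (\<exists>x. (\<exists>i\<in>I. x i \<noteq> 0) \<and> (\<forall>i\<in>I. tensor_apply r I A x i = c * x i ^ (r - 1)))"

definition adjacency_tensor :: "nat \<Rightarrow> 'a hypergraph \<Rightarrow> 'a tensor" where
  "adjacency_tensor r H js = (if set js \<in> hedges H then 1 / fact (r - 1) else 0)"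

text \<open>
  The order \<open>r\<close> is a parameter because a hypergraph without edges does not determine it.
  The supremum is used since the library's \<open>Max\<close> is meaningful only for sets already known
  to be finite; it agrees with the maximum by the lemma below.
\<close>

definition spectral_radius :: "nat \<Rightarrow> 'a hypergraph \<Rightarrow> real" where
  "spectral_radius r H =
     Sup {cmod c | c. tensor_eigenvalue r (hverts H) (adjacency_tensor r H) c}"

lemma spectral_radius_eq_maximum:
  assumes "tensor_eigenvalue r (hverts H) (adjacency_tensor r H) c"
    and "\<And>d. tensor_eigenvalue r (hverts H) (adjacency_tensor r H) d \<Longrightarrow> cmod d \<le> cmod c"
  shows "spectral_radius r H = cmod c"
  unfolding spectral_radius_def by (rule cSup_eq_maximum) (use assms in auto)

end

theory Submission
  imports Defs "HOL-Analysis.Analysis" "HOL-Combinatorics.Multiset_Permutations"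
begin

text \<open>
  The proof is variational.  Write \<open>F x\<close> for the sum over the edges \<open>f\<close> of \<open>\<Prod>v\<in>f. x v\<close>.  On
  nonnegative vectors, \<open>r * F x \<le> \<rho> * (\<Sum>i. x i ^ r)\<close>, and equality holds for some nonnegative
  \<open>x\<close> with \<open>\<Sum>i. x i ^ r = 1\<close>
  (\<open>spectral_radius_variational\<close>): a maximiser exists by compactness, the first order condition
  makes it an eigenvector, and taking absolute values in the eigenvalue equation shows that no
  eigenvalue has larger modulus.  In particular the spectral radius is monotone, so that it is
  enough to remove a single edge \<open>e\<close> from \<open>H\<close>.

  Let \<open>x\<close> be a maximiser for \<open>H - e\<close>, whose spectral radius is \<open>\<rho>\<^sub>1 \<le> \<rho>\<close>.  The entries of \<open>x\<close>
  on one edge differ at most by the factor \<open>\<rho>\<^sub>1\<close> (\<open>maximiser_ratio_on_edge\<close>).  Start from a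
  vertex \<open>w\<close> with \<open>x w ^ r \<ge> 1 / n\<close> and follow a shortest path of \<open>H\<close> towards \<open>e\<close> until it first
  meets \<open>e\<close>, at \<open>v\<close> say.  Up to there it only uses edges of \<open>H - e\<close>, and so
  \<open>x v \<ge> x w / \<rho> ^ D\<close>.  The other entries on \<open>e\<close> may be tiny, or zero if their vertices lie in
  another component of \<open>H - e\<close>.  The remedy is to raise all entries on \<open>e\<close> to at least
  \<open>t = x w / \<rho> ^ (D + 1)\<close>, which gives a test vector for \<open>H\<close>.  The new edge contributes at least \<open>r * (\<rho> * t) * t ^ (r - 1)\<close> to
  \<open>r * F\<close>, and as the entry at \<open>v\<close> stays unchanged, the normalisation grows by at most
  \<open>(r - 1) * t ^ r\<close>.  Thus \<open>\<rho> * (1 + (r - 1) * t ^ r) \<ge> \<rho>\<^sub>1 + r * \<rho> * t ^ r\<close>, which is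
  \<open>\<rho> - \<rho>\<^sub>1 \<ge> \<rho> * t ^ r \<ge> 1 / (n * \<rho> ^ (r * D + r - 1))\<close>.  This is at least the second of
  the two quantities in the minimum.
\<close>

section \<open>The form of a uniform hypergraph and its adjacency tensor\<close>

definition edge_form :: "'a hypergraph \<Rightarrow> ('a \<Rightarrow> 'b::comm_semiring_1) \<Rightarrow> 'b" where
  "edge_form H x = (\<Sum>f\<in>hedges H. \<Prod>v\<in>f. x v)"

lemma uniform_hypergraphD:
  assumes "uniform_hypergraph r H"
  shows "finite (hverts H)" "hverts H \<noteq> {}" "finite (hedges H)"
    and "\<And>f. f \<in> hedges H \<Longrightarrow> f \<subseteq> hverts H"
    and "\<And>f. f \<in> hedges H \<Longrightarrow> card f = r"
    and "\<And>f. f \<in> hedges H \<Longrightarrow> finite f"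
proof -
  show V: "finite (hverts H)" "hverts H \<noteq> {}"
    and E: "\<And>f. f \<in> hedges H \<Longrightarrow> f \<subseteq> hverts H" "\<And>f. f \<in> hedges H \<Longrightarrow> card f = r"
    using assms by (auto simp: uniform_hypergraph_def hypergraph_def)
  show "finite (hedges H)"
    by (rule finite_subset[of _ "Pow (hverts H)"]) (use E V in auto)
  show "\<And>f. f \<in> hedges H \<Longrightarrow> finite f"
    using E(1) V(1) finite_subset by blast
qed

text \<open>
  Each edge through \<open>i\<close> is met once for every ordering of its other \<open>r - 1\<close> vertices, which
  cancels the factor \<open>1 / fact (r - 1)\<close> in the tensor.
\<close>
lemma tensor_apply_adjacency:
  assumes H: "uniform_hypergraph r H" and "r \<ge> 1"
  shows "tensor_apply r (hverts H) (adjacency_tensor r H) x i =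
    (\<Sum>f | f \<in> hedges H \<and> i \<in> f. \<Prod>v\<in>f - {i}. x v)"
proof -
  note fin = uniform_hypergraphD[OF H]
  let ?L = "{js. set js \<subseteq> hverts H \<and> length js = r - 1}"
  let ?F = "{f \<in> hedges H. i \<in> f}"
  have perm: "{js \<in> ?L. set (i # js) = f} = permutations_of_set (f - {i})" if f: "f \<in> ?F" for f
  proof (intro set_eqI iffI)
    fix js assume "js \<in> {js \<in> ?L. set (i # js) = f}"
    then have js: "length js = r - 1" "set (i # js) = f" by auto
    have "distinct (i # js)"
      by (rule card_distinct) (use js fin(5)[of f] f \<open>r \<ge> 1\<close> in auto)
    then show "js \<in> permutations_of_set (f - {i})"
      using js by (auto intro!: permutations_of_setI)
  next
    fix js assume "js \<in> permutations_of_set (f - {i})"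
    then have js: "set js = f - {i}" "distinct js" by (auto dest: permutations_of_setD)
    then have "length js = r - 1"
      using fin(5,6)[of f] f by (metis (lifting) card_Diff_singleton distinct_card mem_Collect_eq)
    then show "js \<in> {js \<in> ?L. set (i # js) = f}" using js f fin(4)[of f] by auto
  qed
  have "tensor_apply r (hverts H) (adjacency_tensor r H) x i =
      (\<Sum>js\<in>?L. \<Sum>f\<in>?F. if set (i # js) = f then prod_list (map x js) / fact (r - 1) else 0)"
    unfolding tensor_apply_def adjacency_tensor_def
    by (intro sum.cong refl) (auto simp: fin(3))
  also have "\<dots> = (\<Sum>f\<in>?F. \<Sum>js\<in>?L. if set (i # js) = f then prod_list (map x js) / fact (r - 1) else 0)"
    by (rule sum.swap)
  also have "\<dots> = (\<Sum>f\<in>?F. \<Sum>js\<in>permutations_of_set (f - {i}). (\<Prod>v\<in>f - {i}. x v) / fact (r - 1))"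
  proof (rule sum.cong[OF refl])
    fix f assume f: "f \<in> ?F"
    have finL: "finite ?L" using finite_lists_length_eq[OF fin(1)] by simp
    have "(\<Sum>js\<in>?L. if set (i # js) = f then prod_list (map x js) / fact (r - 1) else 0)
        = (\<Sum>js\<in>{js\<in>?L. set (i # js) = f}. prod_list (map x js) / fact (r - 1))"
      using finL by (rule sum.inter_filter[symmetric])
    also have "\<dots> = (\<Sum>js\<in>permutations_of_set (f - {i}). (\<Prod>v\<in>f - {i}. x v) / fact (r - 1))"
      unfolding perm[OF f]
      by (rule sum.cong[OF refl]) (metis permutations_of_setD prod.distinct_set_conv_list)
    finally show "(\<Sum>js\<in>?L. if set (i # js) = f then prod_list (map x js) / fact (r - 1) else 0) = \<dots>" .
  qed
  also have "\<dots> = (\<Sum>f\<in>?F. \<Prod>v\<in>f - {i}. x v)"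
  proof (rule sum.cong[OF refl])
    fix f assume f: "f \<in> ?F"
    then have "card (f - {i}) = r - 1" "finite f" using fin(5,6)[of f] by auto
    then show "(\<Sum>js\<in>permutations_of_set (f - {i}). (\<Prod>v\<in>f - {i}. x v) / fact (r - 1)) = (\<Prod>v\<in>f - {i}. x v)"
      by simp
  qed
  finally show ?thesis by simp
qed

text \<open>Euler's identity for the form, which is homogeneous of degree \<open>r\<close>.\<close>
lemma edge_form_euler:
  fixes x :: "'a \<Rightarrow> 'b::comm_semiring_1"
  assumes H: "uniform_hypergraph r H"
  shows "(\<Sum>i\<in>hverts H. x i * (\<Sum>f | f \<in> hedges H \<and> i \<in> f. \<Prod>v\<in>f - {i}. x v)) =
    of_nat r * edge_form H x"
proof -
  note fin = uniform_hypergraphD[OF H]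
  have "(\<Sum>i\<in>hverts H. x i * (\<Sum>f | f \<in> hedges H \<and> i \<in> f. \<Prod>v\<in>f - {i}. x v)) =
      (\<Sum>i\<in>hverts H. \<Sum>f | f \<in> hedges H \<and> i \<in> f. \<Prod>v\<in>f. x v)"
    by (auto intro!: sum.cong simp: sum_distrib_left fin(6) simp flip: prod.remove)
  also have "\<dots> = (\<Sum>f\<in>hedges H. \<Sum>i | i \<in> hverts H \<and> i \<in> f. \<Prod>v\<in>f. x v)"
    using fin(1,3) by (rule sum.swap_restrict)
  also have "\<dots> = (\<Sum>f\<in>hedges H. \<Sum>i\<in>f. \<Prod>v\<in>f. x v)"
    using fin(4) by (intro sum.cong refl) auto
  also have "\<dots> = of_nat r * edge_form H x"
    by (simp add: edge_form_def sum_distrib_left fin(5))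
  finally show ?thesis .
qed

text \<open>
  The form is affine in each single entry, since an edge contains a vertex at most once.
\<close>
lemma edge_form_fun_upd:
  fixes x :: "'a \<Rightarrow> 'b::comm_ring_1"
  assumes H: "uniform_hypergraph r H"
  shows "edge_form H (x(i := s)) =
    s * (\<Sum>f | f \<in> hedges H \<and> i \<in> f. \<Prod>v\<in>f - {i}. x v) + (\<Sum>f | f \<in> hedges H \<and> i \<notin> f. \<Prod>v\<in>f. x v)"
proof -
  note fin = uniform_hypergraphD[OF H]
  have "(\<Prod>v\<in>f. (x(i := s)) v) = s * (\<Prod>v\<in>f - {i}. x v)" if "f \<in> hedges H" "i \<in> f" for f
  proof -
    have "(\<Prod>v\<in>f. (x(i := s)) v) = s * (\<Prod>v\<in>f - {i}. (x(i := s)) v)"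
      using prod.remove[OF fin(6)[OF that(1)] that(2), of "x(i := s)"] by simp
    also have "(\<Prod>v\<in>f - {i}. (x(i := s)) v) = (\<Prod>v\<in>f - {i}. x v)"
      by (rule prod.cong) auto
    finally show ?thesis .
  qed
  moreover have "(\<Prod>v\<in>f. (x(i := s)) v) = (\<Prod>v\<in>f. x v)" if "i \<notin> f" for f
    by (rule prod.cong) (use that in auto)
  moreover have "edge_form H (x(i := s)) = (\<Sum>f\<in>{f\<in>hedges H. i \<in> f}. \<Prod>v\<in>f. (x(i := s)) v) +
      (\<Sum>f\<in>{f\<in>hedges H. i \<notin> f}. \<Prod>v\<in>f. (x(i := s)) v)"
    unfolding edge_form_def using fin(3)
    by (subst sum.union_disjoint[symmetric]) (auto intro!: sum.cong)
  ultimately show ?thesis by (simp add: sum_distrib_left)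
qed

lemma edge_form_raise:
  fixes x z :: "'a \<Rightarrow> real"
  assumes H: "uniform_hypergraph r H" and f: "f \<in> hedges H"
    and x: "\<And>i. 0 \<le> x i" and le: "\<And>i. x i \<le> z i" 
  shows "edge_form H x - (\<Prod>v\<in>f. x v) + (\<Prod>v\<in>f. z v) \<le> edge_form H z"
proof -
  note fin = uniform_hypergraphD[OF H]
  have "(\<Sum>g\<in>hedges H - {f}. \<Prod>v\<in>g. x v) \<le> (\<Sum>g\<in>hedges H - {f}. \<Prod>v\<in>g. z v)"
    by (intro sum_mono prod_mono) (use x le in auto)
  then show ?thesis
    by (simp add: edge_form_def sum.remove[OF fin(3) f])
qed

section \<open>The spectral radius as a maximum of the form\<close>

text \<open>
  The nonnegative vectors on the unit sphere of the \<open>r\<close>-norm, set to zero off the vertex set,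
  form a compact set of functions; homogeneity extends the bound from there to all nonnegative
  vectors.
\<close>
lemma edge_form_maximiser:
  assumes H: "uniform_hypergraph r H" and r: "r \<ge> 1"
  obtains x :: "'a \<Rightarrow> real" and m where "\<And>i. 0 \<le> x i" "(\<Sum>i\<in>hverts H. x i ^ r) = 1"
    "edge_form H x = m" "0 \<le> m"
    "\<And>y. (\<And>i. i \<in> hverts H \<Longrightarrow> 0 \<le> y i) \<Longrightarrow> edge_form H y \<le> m * (\<Sum>i\<in>hverts H. y i ^ r)"
proof -
  note fin = uniform_hypergraphD[OF H]
  let ?V = "hverts H"
  have cont: "continuous_on S (\<lambda>x :: 'a \<Rightarrow> real. x i)" for S i
    by (rule continuous_on_subset[OF continuous_on_product_coordinates subset_UNIV])
  define B where "B = PiE UNIV (\<lambda>i. if i \<in> ?V then {0..1} else {0::real})"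
  define K where "K = {x \<in> B. (\<Sum>i\<in>?V. x i ^ r) = 1}"
  have "compactin (product_topology (\<lambda>i::'a. euclidean::real topology) UNIV) B"
    unfolding B_def by (subst compactin_PiE) simp
  then have "compact B"
    by (simp add: euclidean_product_topology)
  moreover have "closed {x :: 'a \<Rightarrow> real. (\<Sum>i\<in>?V. x i ^ r) = 1}"
    by (intro closed_Collect_eq continuous_intros cont)
  ultimately have "compact K"
    unfolding K_def Collect_conj_eq by (simp add: compact_Int_closed Collect_mem_eq)
  moreover have "K \<noteq> {}"
  proof -
    obtain w where w: "w \<in> ?V" using fin(2) by auto
    have "(\<Sum>i\<in>?V. (if i = w then 1 else 0 :: real) ^ r) = (\<Sum>i\<in>?V. if i = w then 1 else 0)"
      using r by (intro sum.cong) auto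
    then have "(\<lambda>i. if i = w then 1 else 0) \<in> K"
      using w fin(1) by (auto simp: K_def B_def)
    then show ?thesis by blast
  qed
  moreover have "continuous_on K (edge_form H :: _ \<Rightarrow> real)"
    unfolding edge_form_def by (intro continuous_intros cont)
  ultimately obtain x where x: "x \<in> K" "\<And>y. y \<in> K \<Longrightarrow> edge_form H y \<le> edge_form H x"
    using continuous_attains_sup by metis
  have x0: "0 \<le> x i" for i
    using x(1) unfolding K_def B_def PiE_iff by (auto split: if_splits dest!: spec[of _ i])
  have m0: "0 \<le> edge_form H x"
    unfolding edge_form_def by (intro sum_nonneg prod_nonneg ballI x0)
  have bound: "edge_form H y \<le> edge_form H x * (\<Sum>i\<in>?V. y i ^ r)"
    if y: "\<And>i. i \<in> ?V \<Longrightarrow> 0 \<le> y i" for y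
  proof (cases "(\<Sum>i\<in>?V. y i ^ r) = 0")
    case True
    then have z: "y i = 0" if "i \<in> ?V" for i
      using that y fin(1) r by (subst (asm) sum_nonneg_eq_0_iff) auto
    have "(\<Prod>v\<in>f. y v) = 0" if "f \<in> hedges H" for f
    proof -
      have "f \<noteq> {}" using fin(5)[OF that] r by auto
      then show ?thesis using fin(4,6)[OF that] z by auto
    qed
    then show ?thesis unfolding True edge_form_def by simp
  next
    case False
    define N where "N = (\<Sum>i\<in>?V. y i ^ r)"
    have N: "N > 0" using False y unfolding N_def by (simp add: less_le sum_nonneg)
    define c where "c = root r N"
    have c: "c > 0" "c ^ r = N" using N r by (auto simp: c_def)
    define z where "z i = (if i \<in> ?V then y i / c else 0)" for i
    have zs: "(\<Sum>i\<in>?V. z i ^ r) = 1"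
      using N by (simp add: z_def power_divide c(2) flip: sum_divide_distrib N_def)
    have "z i \<le> 1" for i
    proof (cases "i \<in> ?V")
      case True
      have "z i ^ r \<le> 1 ^ r"
        using member_le_sum[OF True, of "\<lambda>i. z i ^ r"] zs fin(1) y c by (auto simp: z_def)
      then show ?thesis using r by (subst (asm) power_mono_iff) (auto simp: z_def y c True less_imp_le)
    qed (simp add: z_def)
    moreover have "0 \<le> z i" for i using y c by (simp add: z_def)
    moreover have "z i = 0" if "i \<notin> ?V" for i using that by (simp add: z_def)
    ultimately have "z \<in> B" by (auto simp: B_def PiE_iff)
    then have "z \<in> K" using zs by (simp add: K_def)
    then have "edge_form H z \<le> edge_form H x" by (rule x(2))
    moreover have "edge_form H z = edge_form H y / N"
    proof -
      have "(\<Prod>v\<in>f. z v) = (\<Prod>v\<in>f. y v) / N" if "f \<in> hedges H" for f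
      proof -
        have "(\<Prod>v\<in>f. z v) = (\<Prod>v\<in>f. y v / c)"
          using fin(4)[OF that] by (intro prod.cong) (auto simp: z_def)
        then show ?thesis by (simp add: prod_dividef fin(5)[OF that] c(2))
      qed
      then show ?thesis by (simp add: edge_form_def sum_divide_distrib)
    qed
    ultimately show ?thesis using N by (simp add: N_def field_simps)
  qed
  show thesis
    by (rule that[of x "edge_form H x"]) (use x0 x(1) m0 bound in \<open>auto simp: K_def\<close>)
qed

text \<open>
  A first order condition that also covers a minimum at the end point \<open>0\<close> of the half-line: there
  the power has derivative zero, which leaves no room for a positive slope \<open>a\<close>.
\<close>
lemma power_minus_linear_min:
  fixes a b u :: real
  assumes r: "r \<ge> 2" and u: "u \<ge> 0" and a: "a \<ge> 0"
    and min: "\<And>s. s \<ge> 0 \<Longrightarrow> b * u ^ r - real r * a * u \<le> b * s ^ r - real r * a * s"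
  shows "a = b * u ^ (r - 1)"
proof (cases "u = 0")
  case False
  have "((\<lambda>s. b * s ^ r - real r * a * s) has_real_derivative
      (b * (real r * u ^ (r - 1)) - real r * a)) (at u)"
    by (auto intro!: derivative_eq_intros)
  then have "b * (real r * u ^ (r - 1)) - real r * a = 0"
    by (rule DERIV_local_min[where d = u]) (use False u min in auto)
  then have "real r * (b * u ^ (r - 1) - a) = 0" by (simp add: algebra_simps)
  then show ?thesis using r by simp
next
  case True
  have le: "real r * a \<le> b * s ^ (r - 1)" if "s > 0" for s
  proof -
    have "real r * a * s \<le> b * s ^ (r - 1) * s"
      using min[of s] that r True by (cases r) (auto simp: ac_simps)
    then show ?thesis using that by simp
  qed
  have ev: "\<forall>\<^sub>F s in at_right 0. real r * a \<le> b * s ^ (r - 1)"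
    using eventually_at_right_less[of "0::real"] by (rule eventually_mono) (rule le)
  have "((\<lambda>s. b * s ^ (r - 1)) \<longlongrightarrow> b * 0 ^ (r - 1)) (at_right 0)"
    by (intro tendsto_intros)
  then have "real r * a \<le> b * 0 ^ (r - 1)"
    using ev by (rule tendsto_lowerbound) simp
  then show ?thesis using r a True by (simp add: zero_power mult_le_0_iff)
qed

text \<open>
  With all other entries fixed, the deficit in the inequality that bounds the form is a function
  of the entry at \<open>i\<close> that is minimal at \<open>x i\<close>; its stationarity is the \<open>i\<close>-th
  eigenvalue equation, even at vertices where the maximiser vanishes.
\<close>
lemma spectral_radius_variational:
  assumes H: "uniform_hypergraph r H" and r: "r \<ge> 2"
  obtains x :: "'a \<Rightarrow> real" where "\<And>i. 0 \<le> x i" "(\<Sum>i\<in>hverts H. x i ^ r) = 1"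
    "real r * edge_form H x = spectral_radius r H"
    "\<And>y. (\<And>i. i \<in> hverts H \<Longrightarrow> 0 \<le> y i) \<Longrightarrow>
      real r * edge_form H y \<le> spectral_radius r H * (\<Sum>i\<in>hverts H. y i ^ r)"
proof -
  note fin = uniform_hypergraphD[OF H]
  let ?V = "hverts H"
  let ?slope = "\<lambda>x i. \<Sum>f | f \<in> hedges H \<and> i \<in> f. \<Prod>v\<in>f - {i}. x v"
  have "r \<ge> 1" using r by simp
  obtain x :: "'a \<Rightarrow> real" and m where x: "\<And>i. 0 \<le> x i" "(\<Sum>i\<in>?V. x i ^ r) = 1"
    "edge_form H x = m" "0 \<le> m"
    and bound: "\<And>y. (\<And>i. i \<in> ?V \<Longrightarrow> 0 \<le> y i) \<Longrightarrow> edge_form H y \<le> m * (\<Sum>i\<in>?V. y i ^ r)"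
    using edge_form_maximiser[OF H \<open>r \<ge> 1\<close>] by metis
  define c where "c = real r * m"
  have c0: "c \<ge> 0" using x(4) by (simp add: c_def)
  have stationary: "?slope x i = c * x i ^ (r - 1)" if i: "i \<in> ?V" for i
  proof (rule power_minus_linear_min[OF r x(1)])
    \<comment> \<open>The deficit, as a function of the entry \<open>s\<close> at \<open>i\<close>, is \<open>c * s ^ r - r * ?slope x i * s\<close>
      up to a constant.\<close>
    show "?slope x i \<ge> 0" by (intro sum_nonneg prod_nonneg ballI x)
    fix s :: real assume s: "s \<ge> 0"
    let ?rest = "\<Sum>f | f \<in> hedges H \<and> i \<notin> f. \<Prod>v\<in>f. x v"
    have "edge_form H (x(i := s)) \<le> m * (\<Sum>j\<in>?V. (x(i := s)) j ^ r)"
      by (rule bound) (use s x in auto)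
    also have "(\<Sum>j\<in>?V. (x(i := s)) j ^ r) = s ^ r + (\<Sum>j\<in>?V - {i}. (x(i := s)) j ^ r)"
      by (subst sum.remove[OF fin(1) i]) simp
    also have "(\<Sum>j\<in>?V - {i}. (x(i := s)) j ^ r) = (\<Sum>j\<in>?V - {i}. x j ^ r)"
      by (rule sum.cong) auto
    also have "\<dots> = 1 - x i ^ r"
      using sum.remove[OF fin(1) i, of "\<lambda>j. x j ^ r"] x(2) by simp
    finally have "s * ?slope x i + ?rest \<le> m * (s ^ r + (1 - x i ^ r))"
      unfolding edge_form_fun_upd[OF H] .
    moreover have "m = x i * ?slope x i + ?rest"
      using edge_form_fun_upd[OF H, of x i "x i"] x(3) by simp
    ultimately have "real r * (m * x i ^ r - ?slope x i * x i) \<le> real r * (m * s ^ r - ?slope x i * s)"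
      by (intro mult_left_mono) (auto simp: algebra_simps)
    then show "c * x i ^ r - real r * ?slope x i * x i \<le> c * s ^ r - real r * ?slope x i * s"
      by (simp add: c_def algebra_simps)
  qed
  let ?z = "\<lambda>i. complex_of_real (x i)"
  have "tensor_eigenvalue r ?V (adjacency_tensor r H) (of_real c)"
    unfolding tensor_eigenvalue_def tensor_apply_adjacency[OF H \<open>r \<ge> 1\<close>]
  proof (intro exI[of _ ?z] conjI ballI)
    show "\<exists>i\<in>?V. ?z i \<noteq> 0"
    proof (rule ccontr)
      assume "\<not> ?thesis"
      then have "(\<Sum>i\<in>?V. x i ^ r) = 0" using r by (intro sum.neutral) auto
      then show False using x(2) by simp
    qed
    fix i assume "i \<in> ?V"
    then show "?slope ?z i = of_real c * ?z i ^ (r - 1)"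
      by (simp flip: of_real_prod of_real_sum of_real_power of_real_mult add: stationary)
  qed
  moreover have "cmod d \<le> c" if "tensor_eigenvalue r ?V (adjacency_tensor r H) d" for d
  proof -
    from that obtain z where z: "\<exists>i\<in>?V. z i \<noteq> 0" "\<And>i. i \<in> ?V \<Longrightarrow> ?slope z i = d * z i ^ (r - 1)"
      unfolding tensor_eigenvalue_def tensor_apply_adjacency[OF H \<open>r \<ge> 1\<close>] by blast
    let ?y = "\<lambda>i. cmod (z i)"
    have "cmod d * (\<Sum>i\<in>?V. ?y i ^ r) = (\<Sum>i\<in>?V. ?y i * cmod (d * z i ^ (r - 1)))"
      unfolding sum_distrib_left
    proof (rule sum.cong[OF refl])
      fix i
      have "?y i ^ r = ?y i * ?y i ^ (r - 1)" using r by (simp flip: power_Suc)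
      then show "cmod d * ?y i ^ r = ?y i * cmod (d * z i ^ (r - 1))"
        by (simp add: norm_mult norm_power)
    qed
    also have "\<dots> = (\<Sum>i\<in>?V. ?y i * cmod (?slope z i))"
      using z(2) by (intro sum.cong) auto
    also have "\<dots> \<le> (\<Sum>i\<in>?V. ?y i * ?slope ?y i)"
      by (intro sum_mono mult_left_mono sum_norm_le) (auto simp: prod_norm)
    also have "\<dots> = real r * edge_form H ?y"
      by (rule edge_form_euler[OF H])
    also have "\<dots> \<le> real r * (m * (\<Sum>i\<in>?V. ?y i ^ r))"
      by (intro mult_left_mono bound) auto
    finally have "cmod d * (\<Sum>i\<in>?V. ?y i ^ r) \<le> c * (\<Sum>i\<in>?V. ?y i ^ r)"
      by (simp add: c_def mult.assoc)
    moreover obtain i where "i \<in> ?V" "z i \<noteq> 0" using z(1) by blast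
    then have "(\<Sum>i\<in>?V. ?y i ^ r) > 0"
      using fin(1) by (intro sum_pos2[of _ i]) auto
    ultimately show ?thesis by simp
  qed
  ultimately have "spectral_radius r H = cmod (of_real c)"
    using c0 by (intro spectral_radius_eq_maximum) auto
  then have sr: "spectral_radius r H = c" using c0 by simp
  show thesis
  proof (rule that[of x])
    show "real r * edge_form H x = spectral_radius r H" by (simp add: sr c_def x(3))
    show "real r * edge_form H y \<le> spectral_radius r H * (\<Sum>i\<in>?V. y i ^ r)"
      if "\<And>i. i \<in> ?V \<Longrightarrow> 0 \<le> y i" for y
      using mult_left_mono[OF bound[of y], of "real r"] that by (simp add: sr c_def mult.assoc)
  qed (use x in auto)
qed

lemma edge_form_le_spectral_radius:
  fixes y :: "'a \<Rightarrow> real"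
  assumes "uniform_hypergraph r H" "r \<ge> 2" "\<And>i. 0 \<le> y i"
  shows "real r * edge_form H y \<le> spectral_radius r H * (\<Sum>i\<in>hverts H. y i ^ r)"
  using spectral_radius_variational[OF assms(1,2)] assms(3) by metis

lemma spectral_radius_nonneg:
  assumes "uniform_hypergraph r H" "r \<ge> 2"
  shows "0 \<le> spectral_radius r H"
proof -
  obtain x :: "'a \<Rightarrow> real" where "\<And>i. 0 \<le> x i" "real r * edge_form H x = spectral_radius r H"
    using spectral_radius_variational[OF assms] by metis
  moreover from this(1) have "0 \<le> edge_form H x"
    unfolding edge_form_def by (intro sum_nonneg prod_nonneg ballI)
  ultimately show ?thesis by (metis mult_nonneg_nonneg of_nat_0_le_iff)
qed

text \<open>Extending a maximiser of the smaller hypergraph by zero gives a test vector for the larger.\<close>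
lemma spectral_radius_mono:
  assumes H: "uniform_hypergraph r H" and sub: "sub_hypergraph r H' H" and r: "r \<ge> 2"
  shows "spectral_radius r H' \<le> spectral_radius r H"
proof -
  have H': "uniform_hypergraph r H'" and VE: "hverts H' \<subseteq> hverts H" "hedges H' \<subseteq> hedges H"
    using sub by (auto simp: sub_hypergraph_def)
  note fin = uniform_hypergraphD[OF H] and fin' = uniform_hypergraphD[OF H']
  obtain x :: "'a \<Rightarrow> real" where x: "\<And>i. 0 \<le> x i" "(\<Sum>i\<in>hverts H'. x i ^ r) = 1"
    "real r * edge_form H' x = spectral_radius r H'"
    using spectral_radius_variational[OF H' r] by metis
  define z where "z i = (if i \<in> hverts H' then x i else 0)" for i
  have z0: "0 \<le> z i" for i using x(1) by (simp add: z_def)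
  have "(\<Sum>i\<in>hverts H. z i ^ r) = (\<Sum>i\<in>hverts H'. x i ^ r)"
    by (rule sum.mono_neutral_cong_right[OF fin(1) VE(1)]) (use r in \<open>auto simp: z_def\<close>)
  then have zs: "(\<Sum>i\<in>hverts H. z i ^ r) = 1" using x(2) by simp
  have "edge_form H' x = (\<Sum>f\<in>hedges H'. \<Prod>v\<in>f. z v)"
    unfolding edge_form_def using fin'(4) by (intro sum.cong prod.cong refl) (auto simp: z_def)
  also have "\<dots> \<le> edge_form H z"
    unfolding edge_form_def by (intro sum_mono2 fin(3) VE(2) prod_nonneg z0)
  finally have "spectral_radius r H' \<le> real r * edge_form H z"
    using x(3) by (metis mult_left_mono of_nat_0_le_iff)
  also have "\<dots> \<le> spectral_radius r H * (\<Sum>i\<in>hverts H. z i ^ r)"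
    by (rule edge_form_le_spectral_radius[OF H r z0])
  finally show ?thesis by (simp add: zs)
qed

text \<open>The indicator function of an edge is the test vector.\<close>
lemma spectral_radius_ge_1:
  assumes H: "uniform_hypergraph r H" and r: "r \<ge> 2" and e: "e \<in> hedges H"
  shows "1 \<le> spectral_radius r H"
proof -
  note fin = uniform_hypergraphD[OF H]
  let ?x = "\<lambda>i. if i \<in> e then 1 else 0 :: real"
  have "(\<Sum>i\<in>hverts H. ?x i ^ r) = (\<Sum>i\<in>e. 1)"
    by (rule sum.mono_neutral_cong_right) (use fin(1,4) e r in auto)
  then have "(\<Sum>i\<in>hverts H. ?x i ^ r) = real r" using fin(5)[OF e] by simp
  moreover have "real r * edge_form H ?x \<le> spectral_radius r H * (\<Sum>i\<in>hverts H. ?x i ^ r)"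
    by (rule edge_form_le_spectral_radius[OF H r]) simp
  moreover have "1 \<le> edge_form H ?x"
  proof -
    have "(\<Prod>v\<in>e. ?x v) \<le> edge_form H ?x"
      unfolding edge_form_def by (rule member_le_sum[OF e _ fin(3)]) (rule prod_nonneg, simp)
    then show ?thesis by simp
  qed
  ultimately have "real r * 1 \<le> real r * spectral_radius r H"
    using mult_left_mono[of 1 "edge_form H ?x" "real r"] by (simp add: mult.commute)
  then show ?thesis using r by simp
qed

section \<open>Entries of a maximiser on an edge\<close>

text \<open>The inequality of the arithmetic and the geometric mean, for the powers \<open>y i ^ card S\<close>.\<close>
lemma prod_le_mean_power:
  fixes y :: "'a \<Rightarrow> real"
  assumes "finite S" "S \<noteq> {}" and y: "\<And>i. i \<in> S \<Longrightarrow> 0 \<le> y i"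
  shows "real (card S) * (\<Prod>i\<in>S. y i) \<le> (\<Sum>i\<in>S. y i ^ card S)"
proof -
  have c: "card S > 0" using assms by (simp add: card_gt_0_iff)
  have "(\<Prod>i\<in>S. y i ^ card S) powr (1 / card S) \<le> (\<Sum>i\<in>S. y i ^ card S / card S)"
    by (rule arith_geom_mean) (use assms in auto)
  also have "(\<Prod>i\<in>S. y i ^ card S) powr (1 / card S) = (\<Prod>i\<in>S. y i)"
    using c y by (simp add: prod_power_distrib[symmetric] root_powr_inverse[symmetric]
        real_root_power_cancel prod_nonneg)
  finally show ?thesis using c by (simp add: field_simps flip: sum_divide_distrib)
qed

text \<open>
  The test vector \<open>z\<close> that raises the entries on \<open>f\<close> to at least \<open>t\<close> cannot beat the maximiser.
  With \<open>y i = min (x i) t\<close>, raising multiplies the product over \<open>f\<close> by \<open>t ^ r / (\<Prod>i\<in>f. y i)\<close>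
  if no entry vanishes, and adds \<open>\<Sum>i\<in>f. t ^ r - y i ^ r\<close> to the normalisation.  By the mean inequality the latter is at
  most \<open>r * (t ^ r - (\<Prod>i\<in>f. y i))\<close>, and the gain of the form has the same factor
  \<open>t ^ r - (\<Prod>i\<in>f. y i)\<close>, which is positive and cancels.  In contrast to an argument from the
  eigenvalue equation, this also works for entries that are zero, and so it can be used to show
  that no edge carries both zero and positive entries.
\<close>
lemma maximiser_raise_edge:
  fixes x :: "'a \<Rightarrow> real"
  assumes H: "uniform_hypergraph r H" and r: "r \<ge> 2"
    and x: "\<And>i. 0 \<le> x i" "(\<Sum>i\<in>hverts H. x i ^ r) = 1" "real r * edge_form H x = spectral_radius r H"
    and f: "f \<in> hedges H" "u \<in> f" and t: "x u < t"
  shows "(\<Prod>i\<in>f. max (x i) t) \<le> spectral_radius r H * t ^ r"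
proof -
  note fin = uniform_hypergraphD[OF H]
  have t0: "t > 0" using x(1)[of u] t by linarith
  let ?\<rho> = "spectral_radius r H"
  define z where "z i = (if i \<in> f then max (x i) t else x i)" for i
  define y where "y i = min (x i) t" for i
  have y0: "0 \<le> y i" for i using x(1) t0 by (simp add: y_def)
  let ?Z = "\<Prod>i\<in>f. max (x i) t" and ?Y = "\<Prod>i\<in>f. y i"
  have card: "finite f" "f \<noteq> {}" "card f = r" using fin(5,6) f by auto
  have Y: "?Y < t ^ r"
  proof -
    have "?Y = y u * (\<Prod>i\<in>f - {u}. y i)" by (rule prod.remove[OF card(1) f(2)])
    also have "\<dots> \<le> x u * (\<Prod>i\<in>f - {u}. t)"
      using x(1) y0 by (intro mult_mono prod_mono prod_nonneg) (auto simp: y_def)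
    also have "\<dots> = x u * t ^ (r - 1)" using card f(2) by simp
    also have "\<dots> < t * t ^ (r - 1)" using t t0 by simp
    also have "\<dots> = t ^ r" using r by (simp flip: power_Suc)
    finally show ?thesis .
  qed
  \<comment> \<open>This is the identity \<open>x i * t = max (x i) t * min (x i) t\<close>, multiplied over the edge.\<close>
  have XZ: "(\<Prod>i\<in>f. x i) * t ^ r = ?Z * ?Y"
  proof -
    have "(\<Prod>i\<in>f. x i) * t ^ r = (\<Prod>i\<in>f. x i * t)" by (simp add: prod.distrib card)
    also have "\<dots> = (\<Prod>i\<in>f. max (x i) t * y i)"
      by (rule prod.cong) (auto simp: y_def max_def min_def)
    finally show ?thesis by (simp add: prod.distrib)
  qed
  have sums: "(\<Sum>i\<in>hverts H. z i ^ r) = 1 + (real r * t ^ r - (\<Sum>i\<in>f. y i ^ r))"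
  proof -
    have "(\<Sum>i\<in>hverts H. z i ^ r) = (\<Sum>i\<in>hverts H. x i ^ r + (if i \<in> f then t ^ r - y i ^ r else 0))"
      by (rule sum.cong) (auto simp: z_def y_def max_def min_def)
    also have "\<dots> = 1 + (\<Sum>i\<in>hverts H. if i \<in> f then t ^ r - y i ^ r else 0)"
      by (simp add: sum.distrib x(2))
    also have "(\<Sum>i\<in>hverts H. if i \<in> f then t ^ r - y i ^ r else 0) = (\<Sum>i\<in>f. t ^ r - y i ^ r)"
      using fin(1) fin(4)[OF f(1)] by (intro sum.mono_neutral_cong_right) auto
    finally show ?thesis by (simp add: sum_subtractf card)
  qed
  have \<rho>0: "0 \<le> ?\<rho>" by (rule spectral_radius_nonneg[OF H r])
  have "real r * (?Z - (\<Prod>i\<in>f. x i)) \<le> real r * edge_form H z - ?\<rho>"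
  proof -
    have "edge_form H x - (\<Prod>i\<in>f. x i) + (\<Prod>i\<in>f. z i) \<le> edge_form H z"
      by (rule edge_form_raise[OF H f(1) x(1)]) (simp add: z_def)
    moreover have "(\<Prod>i\<in>f. z i) = ?Z" by (simp add: z_def)
    ultimately have "real r * (edge_form H x - (\<Prod>i\<in>f. x i) + ?Z) \<le> real r * edge_form H z"
      by (intro mult_left_mono) auto
    then show ?thesis using x(3) by (simp add: algebra_simps)
  qed
  also have "real r * edge_form H z \<le> ?\<rho> * (\<Sum>i\<in>hverts H. z i ^ r)"
  proof -
    have "0 \<le> z i" for i using x(1) t0 by (simp add: z_def le_max_iff_disj)
    then show ?thesis by (rule edge_form_le_spectral_radius[OF H r])
  qed
  also have "?\<rho> * (\<Sum>i\<in>hverts H. z i ^ r) - ?\<rho> = ?\<rho> * (real r * t ^ r - (\<Sum>i\<in>f. y i ^ r))"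
    by (simp add: sums algebra_simps)
  also have "\<dots> \<le> ?\<rho> * (real r * t ^ r - real r * ?Y)"
    using prod_le_mean_power[OF card(1,2), of y] y0 \<rho>0 by (intro mult_left_mono) (auto simp: card)
  finally have "real r * (?Z - (\<Prod>i\<in>f. x i)) \<le> real r * (?\<rho> * (t ^ r - ?Y))"
    by (simp add: algebra_simps)
  then have "(?Z - (\<Prod>i\<in>f. x i)) * t ^ r \<le> ?\<rho> * (t ^ r - ?Y) * t ^ r"
    using r t0 by simp
  then have "?Z * (t ^ r - ?Y) \<le> (?\<rho> * t ^ r) * (t ^ r - ?Y)"
    using XZ by (simp add: algebra_simps)
  then show ?thesis using Y by simp
qed

text \<open>
  Raise the edge to a level \<open>t\<close> just above \<open>x u\<close>.  The raised product is at least
  \<open>x v * t ^ (r - 1)\<close>, hence \<open>x v \<le> \<rho> * t\<close>; then let \<open>t\<close> tend to \<open>x u\<close>.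
\<close>
lemma maximiser_ratio_on_edge:
  fixes x :: "'a \<Rightarrow> real"
  assumes H: "uniform_hypergraph r H" and r: "r \<ge> 2"
    and x: "\<And>i. 0 \<le> x i" "(\<Sum>i\<in>hverts H. x i ^ r) = 1" "real r * edge_form H x = spectral_radius r H"
    and f: "f \<in> hedges H" "u \<in> f" "v \<in> f"
  shows "x v \<le> spectral_radius r H * x u"
proof -
  note fin = uniform_hypergraphD[OF H]
  let ?\<rho> = "spectral_radius r H"
  have le: "x v \<le> ?\<rho> * t" if t: "x u < t" for t
  proof -
    have t0: "t > 0" using x(1)[of u] t by linarith
    have card: "card (f - {v}) = r - 1" using fin(5,6) f by simp
    have "x v * t ^ (r - 1) \<le> max (x v) t * (\<Prod>i\<in>f - {v}. max (x i) t)"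
      using t0 x(1) prod_mono[of "f - {v}" "\<lambda>_. t" "\<lambda>i. max (x i) t"]
      by (intro mult_mono) (auto simp: card)
    also have "\<dots> = (\<Prod>i\<in>f. max (x i) t)"
      using fin(6)[OF f(1)] f(3) by (rule prod.remove[symmetric])
    also have "\<dots> \<le> ?\<rho> * t ^ r"
      by (rule maximiser_raise_edge[OF H r x f(1,2) t])
    also have "\<dots> = (?\<rho> * t) * t ^ (r - 1)" using r by (cases r) auto
    finally show ?thesis using t0 by simp
  qed
  have ev: "\<forall>\<^sub>F t in at_right (x u). x v \<le> ?\<rho> * t"
    using eventually_at_right_less[of "x u"] by (rule eventually_mono) (rule le)
  have "((\<lambda>t. ?\<rho> * t) \<longlongrightarrow> ?\<rho> * x u) (at_right (x u))"
    by (intro tendsto_intros)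
  then show ?thesis
    using ev by (rule tendsto_lowerbound) simp
qed

section \<open>Reaching the removed edge\<close>
lemma hdist_attained:
  assumes "hconnected H" "u \<in> hverts H" "v \<in> hverts H"
  obtains vs es where "hpath_between H u vs es v" "length es = hdist H u v"
proof -
  have "\<exists>l vs es. hpath_between H u vs es v \<and> length es = l"
    using assms unfolding hconnected_def by blast
  from LeastI_ex[OF this] show thesis
    unfolding hdist_def[symmetric] using that by blast
qed

lemma hdist_le_hdiameter:
  assumes "finite (hverts H)" "u \<in> hverts H" "v \<in> hverts H"
  shows "hdist H u v \<le> hdiameter H"
proof -
  have "finite ((\<lambda>(u, v). hdist H u v) ` (hverts H \<times> hverts H))" using assms(1) by blast
  also have "(\<lambda>(u, v). hdist H u v) ` (hverts H \<times> hverts H) =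
      {hdist H u v | u v. u \<in> hverts H \<and> v \<in> hverts H}" by auto
  finally show ?thesis unfolding hdiameter_def by (rule Max_ge) (use assms in auto)
qed

text \<open>
  A path of \<open>H\<close> does not use \<open>e\<close> before it meets a vertex of \<open>e\<close>, so up to that vertex the entries
  can be compared along edges of \<open>H1\<close>.
\<close>
lemma maximiser_large_on_removed_edge:
  fixes x :: "'a \<Rightarrow> real"
  assumes H: "uniform_hypergraph r H" "hconnected H" and r: "r \<ge> 2"
    and e: "e \<in> hedges H" and H1: "uniform_hypergraph r H1" "hverts H1 = hverts H"
      "hedges H1 = hedges H - {e}"
    and x: "\<And>i. 0 \<le> x i" "(\<Sum>i\<in>hverts H1. x i ^ r) = 1" "real r * edge_form H1 x = spectral_radius r H1"
    and \<rho>: "spectral_radius r H1 \<le> \<rho>" "1 \<le> \<rho>" and w: "w \<in> hverts H"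
  obtains v where "v \<in> e" "x w \<le> \<rho> ^ hdiameter H * x v"
proof -
  note fin = uniform_hypergraphD[OF H(1)]
  obtain v0 where v0: "v0 \<in> e" using fin(5)[OF e] r by fastforce
  then have "v0 \<in> hverts H" using fin(4) e by blast
  then obtain vs es where p: "hpath_between H w vs es v0" "length es = hdist H w v0"
    using hdist_attained[OF H(2) w] by metis
  have len: "length es \<le> hdiameter H"
    using hdist_le_hdiameter[OF fin(1) w \<open>v0 \<in> hverts H\<close>] p(2) by simp
  have ne: "vs \<noteq> []" using p(1) by (auto simp: hpath_between_def hpath_def)
  have vs: "length vs = Suc (length es)" "set es \<subseteq> hedges H"
    "\<And>i. i < length es \<Longrightarrow> vs ! i \<in> es ! i \<and> vs ! Suc i \<in> es ! i"
    "vs ! 0 = w" "vs ! length es = v0"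
    using p(1) unfolding hpath_between_def hpath_def
    by (auto simp: hd_conv_nth[OF ne] last_conv_nth[OF ne])
  define k where "k = (LEAST k. vs ! k \<in> e)"
  have k: "vs ! k \<in> e" "k \<le> length es"
    unfolding k_def using vs(5) v0 by (auto intro: LeastI Least_le)
  have bef: "vs ! i \<notin> e" if "i < k" for i
    using that not_less_Least unfolding k_def by blast
  have "x w \<le> \<rho> ^ i * x (vs ! i)" if "i \<le> k" for i
    using that
  proof (induction i)
    case (Suc i)
    then have i: "i < length es" "vs ! i \<notin> e" using k(2) bef by auto
    then have "es ! i \<in> hedges H1" using vs(2,3) H1(3) by (metis Diff_iff nth_mem singletonD subsetD)
    then have "x (vs ! i) \<le> spectral_radius r H1 * x (vs ! Suc i)"
      using vs(3)[OF i(1)] by (intro maximiser_ratio_on_edge[OF H1(1) r x]) auto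
    also have "\<dots> \<le> \<rho> * x (vs ! Suc i)" using \<rho> x(1) by (intro mult_right_mono)
    finally have "\<rho> ^ i * x (vs ! i) \<le> \<rho> ^ i * (\<rho> * x (vs ! Suc i))"
      using \<rho> by (intro mult_left_mono) auto
    then show ?case using Suc by (simp add: ac_simps)
  qed (simp add: vs(4))
  then have "x w \<le> \<rho> ^ k * x (vs ! k)" by simp
  also have "\<dots> \<le> \<rho> ^ hdiameter H * x (vs ! k)"
    using \<rho> k(2) len x(1) by (intro mult_right_mono power_increasing) auto
  finally show thesis using k(1) that by blast
qed

text \<open>
  If a vertex is missing then so is an edge, because in a connected hypergraph with at least two
  vertices every vertex lies in an edge.
\<close>
lemma proper_sub_hypergraph_misses_edge:
  assumes H: "uniform_hypergraph r H" "hconnected H" and H': "proper_sub_hypergraph r H' H"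
  obtains e where "e \<in> hedges H" "e \<notin> hedges H'"
proof -
  have sub: "uniform_hypergraph r H'" "hverts H' \<subseteq> hverts H" "hedges H' \<subseteq> hedges H" "H' \<noteq> H"
    using H' by (auto simp: proper_sub_hypergraph_def sub_hypergraph_def)
  note fin' = uniform_hypergraphD[OF sub(1)]
  have "hedges H' \<noteq> hedges H"
  proof
    assume E: "hedges H' = hedges H"
    then have "hverts H' \<noteq> hverts H" using sub(4) hypergraph.equality[of H' H] by auto
    then obtain v where v: "v \<in> hverts H" "v \<notin> hverts H'" using sub(2) by blast
    obtain u where u: "u \<in> hverts H'" using fin'(2) by blast
    then obtain vs es where p: "hpath_between H u vs es v"
      using H(2) sub(2) v(1) unfolding hconnected_def by blast
    then have ne: "vs \<noteq> []" by (auto simp: hpath_between_def hpath_def)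
    from p have vs: "length vs = Suc (length es)" "set es \<subseteq> hedges H"
      "\<And>i. i < length es \<Longrightarrow> vs ! Suc i \<in> es ! i" "vs ! 0 = u" "vs ! length es = v"
      unfolding hpath_between_def hpath_def by (auto simp: hd_conv_nth[OF ne] last_conv_nth[OF ne])
    have "length es \<noteq> 0" using vs(4,5) u v(2) by metis
    then obtain l where l: "length es = Suc l" using not0_implies_Suc by blast
    then have "v \<in> es ! l" "es ! l \<in> hedges H'" using vs(2,3,5) E by (auto simp: subset_iff)
    then show False using fin'(4) v(2) by blast
  qed
  then show thesis using that sub(3) by blast
qed

section \<open>The gap\<close>

text \<open>
  The test vector is the maximiser of the smaller hypergraph with the entries on \<open>e\<close> raised to at
  least \<open>t\<close>.  One entry on \<open>e\<close> is already as large as \<open>\<rho> * t\<close>; this choice of \<open>t\<close> makes the gain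
  \<open>r * \<rho> * t ^ r\<close> from the edge exceed the loss \<open>(r - 1) * \<rho> * t ^ r\<close> from the normalisation.
\<close>
lemma spectral_radius_remove_edge:
  assumes H: "uniform_hypergraph r H" "hconnected H" and r: "r \<ge> 2" and e: "e \<in> hedges H"
  defines "\<rho> \<equiv> spectral_radius r H"
  shows "1 / (real (card (hverts H)) * \<rho> ^ (r * hdiameter H + (r - 1))) \<le>
    \<rho> - spectral_radius r (H\<lparr>hedges := hedges H - {e}\<rparr>)"
proof -
  note fin = uniform_hypergraphD[OF H(1)]
  let ?V = "hverts H" and ?D = "hdiameter H"
  define H1 where "H1 = H\<lparr>hedges := hedges H - {e}\<rparr>"
  have V1: "hverts H1 = ?V" and E1: "hedges H1 = hedges H - {e}" by (simp_all add: H1_def)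
  have H1: "uniform_hypergraph r H1"
    using H(1) by (auto simp: H1_def uniform_hypergraph_def hypergraph_def)
  let ?\<rho>1 = "spectral_radius r H1"
  have \<rho>1: "?\<rho>1 \<le> \<rho>" unfolding \<rho>_def
    by (rule spectral_radius_mono[OF H(1) _ r]) (use H1 V1 E1 in \<open>auto simp: sub_hypergraph_def\<close>)
  have \<rho>: "1 \<le> \<rho>" unfolding \<rho>_def by (rule spectral_radius_ge_1[OF H(1) r e])
  obtain x :: "'a \<Rightarrow> real" where x: "\<And>i. 0 \<le> x i" "(\<Sum>i\<in>hverts H1. x i ^ r) = 1"
    "real r * edge_form H1 x = ?\<rho>1"
    using spectral_radius_variational[OF H1 r] by metis
  have n: "card ?V > 0" using fin(1,2) by (simp add: card_gt_0_iff)
  \<comment> \<open>Some summand of \<open>\<Sum>i\<in>?V. x i ^ r = 1\<close> reaches the average.\<close>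
  have "\<exists>w\<in>?V. 1 / real (card ?V) \<le> x w ^ r"
  proof (rule ccontr)
    assume "\<not> ?thesis"
    then have "(\<Sum>i\<in>?V. x i ^ r) < (\<Sum>i\<in>?V. 1 / real (card ?V))"
      using fin(1,2) by (intro sum_strict_mono) auto
    then show False using x(2) V1 n by simp
  qed
  then obtain w where w: "w \<in> ?V" "1 / real (card ?V) \<le> x w ^ r" by blast
  obtain v where v: "v \<in> e" "x w \<le> \<rho> ^ ?D * x v"
    using maximiser_large_on_removed_edge[OF H r e H1 V1 E1 x \<rho>1 \<rho> w(1)] by metis
  define t where "t = x w / \<rho> ^ (?D + 1)"
  have t0: "t \<ge> 0" using x(1) \<rho> by (simp add: t_def)
  have vt: "\<rho> * t \<le> x v" using v(2) \<rho> by (simp add: t_def field_simps)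
  have "1 * t \<le> \<rho> * t" using \<rho> t0 by (intro mult_right_mono)
  then have vt1: "t \<le> x v" using vt by simp
  define z where "z i = (if i \<in> e then max (x i) t else x i)" for i
  have xz: "x i \<le> z i" for i by (simp add: z_def)
  have z0: "0 \<le> z i" for i using x(1) xz order_trans by blast
  have Ze: "\<rho> * t ^ r \<le> (\<Prod>i\<in>e. z i)"
  proof -
    have "\<rho> * t ^ r = (\<rho> * t) * (\<Prod>i\<in>e - {v}. t)"
      using fin(5,6)[OF e] v(1) r by (cases r) auto
    also have "\<dots> \<le> z v * (\<Prod>i\<in>e - {v}. z i)"
      using t0 vt z0 \<rho> by (intro mult_mono prod_mono prod_nonneg) (auto simp: z_def)
    also have "\<dots> = (\<Prod>i\<in>e. z i)"
      using prod.remove[OF fin(6)[OF e] v(1), of z] by simp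
    finally show ?thesis .
  qed
  have form: "edge_form H1 x + (\<Prod>i\<in>e. z i) \<le> edge_form H z"
  proof -
    have "edge_form H1 x \<le> edge_form H1 z"
      unfolding edge_form_def by (intro sum_mono prod_mono) (use x xz in auto)
    then show ?thesis
      unfolding edge_form_def E1 by (simp add: sum.remove[OF fin(3) e])
  qed
  have norm: "(\<Sum>i\<in>?V. z i ^ r) \<le> 1 + real (r - 1) * t ^ r"
  proof -
    have "(\<Sum>i\<in>?V. z i ^ r) \<le> (\<Sum>i\<in>?V. x i ^ r + (if i \<in> e - {v} then t ^ r else 0))"
      using vt1 t0 x(1) by (intro sum_mono) (auto simp: z_def max_def)
    also have "\<dots> = 1 + (\<Sum>i\<in>?V. if i \<in> e - {v} then t ^ r else 0)"
      using x(2) V1 by (simp add: sum.distrib)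
    also have "(\<Sum>i\<in>?V. if i \<in> e - {v} then t ^ r else 0) = (\<Sum>i\<in>e - {v}. t ^ r)"
      using fin(1) fin(4)[OF e] by (intro sum.mono_neutral_cong_right) auto
    also have "\<dots> = real (r - 1) * t ^ r" using fin(5,6)[OF e] v(1) by simp
    finally show ?thesis .
  qed
  have "?\<rho>1 + real r * (\<rho> * t ^ r) \<le> ?\<rho>1 + real r * (\<Prod>i\<in>e. z i)"
    using Ze by (simp add: mult_left_mono)
  also have "\<dots> = real r * (edge_form H1 x + (\<Prod>i\<in>e. z i))"
    by (simp add: distrib_left x(3))
  also have "\<dots> \<le> real r * edge_form H z" using form by (simp add: mult_left_mono)
  also have "\<dots> \<le> \<rho> * (\<Sum>i\<in>?V. z i ^ r)"
    unfolding \<rho>_def by (rule edge_form_le_spectral_radius[OF H(1) r z0])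
  also have "\<dots> \<le> \<rho> * (1 + real (r - 1) * t ^ r)"
    using norm \<rho> by (intro mult_left_mono) auto
  finally have gap: "\<rho> * t ^ r \<le> \<rho> - ?\<rho>1"
    using r by (simp add: of_nat_diff algebra_simps)
  have "1 / (real (card ?V) * \<rho> ^ (r * ?D + (r - 1))) = (1 / real (card ?V)) / \<rho> ^ (r * ?D + (r - 1))"
    by simp
  also have "\<dots> \<le> x w ^ r / \<rho> ^ (r * ?D + (r - 1))"
    using w(2) \<rho> by (intro divide_right_mono) auto
  also have "\<dots> = \<rho> * t ^ r"
  proof -
    have "\<rho> ^ ((?D + 1) * r) = \<rho> * \<rho> ^ (r * ?D + (r - 1))"
      using r by (cases r) (auto simp: algebra_simps simp flip: power_Suc power_add)
    then have "t ^ r = x w ^ r / (\<rho> * \<rho> ^ (r * ?D + (r - 1)))"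
      by (simp only: t_def power_divide power_mult[symmetric])
    then show ?thesis using \<rho> by simp
  qed
  finally show ?thesis using gap by (simp add: H1_def)
qed

theorem theorem4p2:
  fixes H H' :: "'a hypergraph" and r n D :: nat and \<rho> :: real
  assumes "r \<ge> 2"
    and "uniform_hypergraph r H"
    and "hconnected H"
    and "n = card (hverts H)"
    and "D = hdiameter H"
    and "\<rho> = spectral_radius r H"
    and "proper_sub_hypergraph r H' H"
  shows "spectral_radius r H - spectral_radius r H' \<ge>
    min (real r / (real n * \<rho> ^ (r * (r - 1) * (D + 1))))
        (1 / (real n * \<rho> ^ (r * D) * (\<rho> ^ (r - 1) + real r - 1)))"
proof -
  note r = assms(1) and H = assms(2,3)
  obtain e where e: "e \<in> hedges H" "e \<notin> hedges H'"
    using proper_sub_hypergraph_misses_edge[OF H assms(7)] by metis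
  let ?H1 = "H\<lparr>hedges := hedges H - {e}\<rparr>"
  have H1: "uniform_hypergraph r ?H1"
    using H(1) by (auto simp: uniform_hypergraph_def hypergraph_def)
  have "sub_hypergraph r H' ?H1"
    using assms(7) e(2) by (auto simp: proper_sub_hypergraph_def sub_hypergraph_def)
  then have mono: "spectral_radius r H' \<le> spectral_radius r ?H1"
    by (rule spectral_radius_mono[OF H1 _ r])
  have \<rho>: "1 \<le> \<rho>" unfolding assms(6) by (rule spectral_radius_ge_1[OF H(1) r e(1)])
  have n: "n > 0" using uniform_hypergraphD(1,2)[OF H(1)] assms(4) by (simp add: card_gt_0_iff)
  have "1 / (real n * \<rho> ^ (r * D) * (\<rho> ^ (r - 1) + real r - 1)) \<le>
      1 / (real n * \<rho> ^ (r * D) * \<rho> ^ (r - 1))"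
  proof (rule divide_left_mono)
    show "real n * \<rho> ^ (r * D) * \<rho> ^ (r - 1) \<le> real n * \<rho> ^ (r * D) * (\<rho> ^ (r - 1) + real r - 1)"
      using \<rho> r by (intro mult_left_mono) auto
    show "0 < real n * \<rho> ^ (r * D) * (\<rho> ^ (r - 1) + real r - 1) * (real n * \<rho> ^ (r * D) * \<rho> ^ (r - 1))"
      using \<rho> r n by (intro mult_pos_pos) (auto intro: add_pos_nonneg simp: add_diff_eq[symmetric])
  qed simp
  also have "\<dots> = 1 / (real n * \<rho> ^ (r * D + (r - 1)))" by (simp add: power_add)
  also have "\<dots> \<le> \<rho> - spectral_radius r ?H1"
    unfolding assms(4-6) by (rule spectral_radius_remove_edge[OF H r e(1)])
  also have "\<dots> \<le> spectral_radius r H - spectral_radius r H'"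
    using mono assms(6) by simp
  finally show ?thesis by (rule min.coboundedI2)
qed

end
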